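(* Let $q$ be a prime power and let $F \in \mathbb{F}_q[T]$ be a polynomial of degree $k$ with zero constant term, such that the number of roots of $F$ in $\mathbb{F}_q$ is coprime to $q$. Set $c'(k,q) := (2 k^2 (q - 1)^2 (1 + \log_q k)^2 \log q)^{-1}$. Let $n \geq 1$ be an integer. If $A \subset P_{q,n}$ is a set with $|A| > 2 q^{(1 - c'(k,q))n}$, then $A$ contains distinct polynomials $p(T), p'(T)$ such that $p(T) - p'(T) = F(b(T))$ for some $b \in \mathbb{F}_q[T]$.
   Context: For a prime power $q$ and integer $n$, $P_{q,n}$ denotes the $n$-dimensional vector space over $\mathbb{F}_q$ consisting of all polynomials $c_0 + c_1 T + \dots + c_{n-1} T^{n-1}$ with $c_i \in \mathbb{F}_q$ (polynomials in the indeterminate $T$ of degree $< n$). Here $\log$ denotes the natural logarithm and $\log_q$ the logarithm to base $q$. *)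

theory Defs
  imports Complex_Main "HOL-Library.Cardinality" "HOL-Computational_Algebra.Polynomial"
begin

text \<open>
  The field with \<open>q\<close> elements is a type \<open>'a :: {field, finite}\<close> with \<open>q = CARD('a)\<close>;
  such a \<open>q\<close> is automatically a prime power, and every prime power arises in this way.
\<close>

definition polys_below :: "nat \<Rightarrow> 'a::field poly set" where
  "polys_below n = {\<Sum>i<n. monom (c i) i | c :: nat \<Rightarrow> 'a. True}"

definition c' :: "nat \<Rightarrow> nat \<Rightarrow> real" where
  "c' k q = inverse (2 * real k ^ 2 * (real q - 1) ^ 2 * (1 + log (real q) (real k)) ^ 2 * ln (real q))"

end

theory Submission
  imports Defs "HOL-Probability.Hoeffding"
begin

text \<open>
  The Croot--Lev--Pach method. Put \<open>m = \<lceil>n / k\<rceil>\<close>, so that \<open>b \<mapsto> F(b)\<close> maps polynomials of degree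
  below \<open>m\<close> to polynomials of degree below \<open>n\<close>. Since \<open>q\<close>-th powers are linear, the coefficients of
  \<open>F(b)\<close> have degree at most \<open>D = L (q - 1)\<close> in those of \<open>b\<close>, where \<open>L \<le> 1 + log\<^sub>q k\<close> is the number of
  base-\<open>q\<close> digits of \<open>k\<close>. The number of solutions \<open>b\<close> of \<open>F(b) = z\<close>, as an element of the field, is a
  polynomial in the coefficients of \<open>z\<close>; as summing over \<open>b\<close> kills monomials of degree below
  \<open>m (q - 1)\<close>, its degree is at most \<open>(q - 1) (n - m / D)\<close>. If \<open>A\<close> has no difference of the form \<open>F(b)\<close>,
  then on \<open>x - y\<close> with \<open>x, y \<in> A\<close> this polynomial vanishes off the diagonal, while at \<open>0\<close> it is the
  number of roots of \<open>F\<close> in the field, which is nonzero there by coprimality. In each monomial in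
  \<open>x\<close> and \<open>y\<close> one of the two factors has at most half the degree, so \<open>|A|\<close> is at most twice the number of
  reduced monomials of that half degree, which Hoeffding's inequality bounds.
\<close>

section \<open>Finite fields\<close>

text \<open>Multiplication by \<open>x \<noteq> 0\<close> permutes the nonzero elements, so their
  product absorbs a factor x^(q - 1). One more factor \<open>x\<close> on both sides turns this into
  x^q.\<close>

lemma power_card_eq_same:
  fixes x :: "'a::{field, finite}"
  shows "x ^ CARD('a) = x"
proof (cases "x = 0")
  case False
  have "x * (\<Prod>y\<in>UNIV-{0}. x * y) = x * x ^ (CARD('a) - 1) * \<Prod>(UNIV-{0})"
    by (simp add: prod.distrib mult_ac)
  also have "x * x ^ (CARD('a) - 1) = x ^ CARD('a)"
    by (metis finite power_eq_if card_eq_0_iff UNIV_not_empty)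
  also have "(\<Prod>y\<in>UNIV-{0}. x * y) = (\<Prod>y\<in>UNIV-{0}. y)"
    by (rule prod.reindex_bij_witness[of _ "\<lambda>y. y / x" "\<lambda>y. x * y"]) (use False in auto)
  finally show ?thesis
    by simp
qed simp

lemma CARD_ge_2: "CARD('a::{zero_neq_one, finite}) \<ge> 2"
  using card_mono[of UNIV "{0, 1 :: 'a}"] by simp

lemma power_card_minus_one:
  fixes x :: "'a::{field, finite}"
  shows "x ^ (CARD('a) - 1) = (if x = 0 then 0 else 1)"
proof (cases "x = 0")
  case False
  have "x * x ^ (CARD('a) - 1) = x * 1"
    using power_card_eq_same[of x]
    by (metis CARD_ge_2 Suc_diff_1 less_le_trans mult.right_neutral pos2 power_Suc)
  then show ?thesis using False by simp
qed (use CARD_ge_2[where 'a = 'a] in \<open>simp add: power_0_left\<close>)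

text \<open>Translation by 1 permutes the field, so the sum of all elements equals itself plus
  q.\<close>

lemma of_nat_card_eq_0: "of_nat CARD('a) = (0 :: 'a::{field, finite})"
proof -
  have "(\<Sum>x\<in>(UNIV :: 'a set). x + 1) = (\<Sum>x\<in>UNIV. x)"
    by (rule sum.reindex_bij_witness[of _ "\<lambda>x. x - 1" "\<lambda>x. x + 1"]) auto
  then show ?thesis by (simp add: sum.distrib)
qed

text \<open>If \<open>of_nat r\<close> were 0, the characteristic would divide both \<open>r\<close>
  and q. Applied to the number of roots of \<open>F\<close>, this makes the diagonal
  nonzero.\<close>

lemma of_nat_coprime_card_neq_0:
  assumes "coprime r CARD('a)"
  shows "of_nat r \<noteq> (0 :: 'a::{field, finite})"
proof
  assume r: "of_nat r = (0 :: 'a)"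
  have "CHAR('a) dvd r" "CHAR('a) dvd CARD('a)"
    using r of_nat_card_eq_0[where 'a = 'a] by (simp_all only: of_nat_eq_0_iff_char_dvd)
  then have "CHAR('a) = 1" using assms coprime_common_divisor_nat by blast
  then show False by simp
qed

text \<open>Substituting \<open>g * x\<close> multiplies the sum by \<open>g ^ e\<close>. For
  \<open>e > 0\<close> some nonzero \<open>g\<close> has \<open>g ^ e \<noteq> 1\<close>, because
  T^e - 1 has at most e < q - 1 roots; for \<open>e = 0\<close> the sum is q, which is 0 in the
  field.\<close>

lemma sum_power_eq_0:
  assumes "e < CARD('a) - 1"
  shows "(\<Sum>x\<in>UNIV. x ^ e) = (0 :: 'a::{field, finite})"
proof (cases "e = 0")
  case True
  then show ?thesis using of_nat_card_eq_0[where 'a = 'a] by simp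
next
  case False
  have "\<exists>g :: 'a. g \<noteq> 0 \<and> g ^ e \<noteq> 1"
  proof (rule ccontr)
    assume *: "\<not> ?thesis"
    define P where "P = monom 1 e - (1 :: 'a poly)"
    have deg: "degree P \<le> e"
      unfolding P_def by (intro degree_diff_le degree_monom_le) auto
    have "coeff P e = 1" using False by (simp add: P_def coeff_eq_0)
    then have "P \<noteq> 0" by auto
    have "CARD('a) - 1 = card (UNIV - {0 :: 'a})" by (simp add: card_Diff_subset)
    also have "\<dots> \<le> card {x. poly P x = 0}"
      using * by (intro card_mono) (auto simp: P_def poly_monom)
    also have "\<dots> \<le> degree P" by (rule card_poly_roots_bound) fact
    finally show False using deg assms by simp
  qed
  then obtain g :: 'a where g: "g \<noteq> 0" "g ^ e \<noteq> 1" by blast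
  have "(\<Sum>x\<in>UNIV. (g * x) ^ e) = (\<Sum>x\<in>UNIV. x ^ e)"
    by (rule sum.reindex_bij_witness[of _ "\<lambda>y. y / g" "\<lambda>y. g * y"]) (use g in auto)
  then have "g ^ e * (\<Sum>x\<in>UNIV. x ^ e) = 1 * (\<Sum>x\<in>UNIV. x ^ e)"
    by (simp add: power_mult_distrib sum_distrib_left)
  then show ?thesis using g by simp
qed

text \<open>The polynomial \<open>(T + 1)\<^sup>q - T\<^sup>q - 1\<close> has degree less than \<open>q\<close> but vanishes at all \<open>q\<close> points.\<close>
lemma of_nat_card_choose_eq_0:
  assumes "0 < i" "i < CARD('a)"
  shows "of_nat (CARD('a) choose i) = (0 :: 'a::{field, finite})"
proof -
  let ?q = "CARD('a)"
  define P where "P = (\<Sum>i\<in>{0<..<?q}. monom (of_nat (?q choose i) :: 'a) i)"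
  have "P = 0"
  proof (rule poly_eqI_degree[of UNIV])
    fix x :: 'a
    have "x + 1 = (x + 1) ^ ?q" by (simp add: power_card_eq_same)
    also have "\<dots> = (\<Sum>i\<le>?q. of_nat (?q choose i) * x ^ i)"
      by (simp add: binomial_ring)
    also have "{..?q} = insert 0 (insert ?q {0<..<?q})" by auto
    also have "(\<Sum>i\<in>\<dots>. of_nat (?q choose i) * x ^ i) = 1 + x + poly P x"
      by (simp add: P_def poly_sum poly_monom power_card_eq_same)
    finally show "poly P x = poly 0 x" by simp
  next
    have "degree P \<le> ?q - 1" unfolding P_def
      by (intro degree_sum_le) (auto intro: order.trans[OF degree_monom_le])
    then show "degree P < card (UNIV :: 'a set)"
      using CARD_ge_2[where 'a = 'a] by simp
  qed (use CARD_ge_2[where 'a = 'a] in simp)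
  then have "coeff P i = 0" by simp
  then show ?thesis using assms by (simp add: P_def coeff_sum)
qed

text \<open>The inner binomial coefficients vanish, so the Frobenius map is additive. It fixes
  constants and sends T to T^q, which gives the induction step for a + T p.\<close>

lemma poly_power_card:
  fixes p :: "'a::{field, finite} poly"
  shows "p ^ CARD('a) = pcompose p (monom 1 (CARD('a)))"
proof (induction p)
  case 0
  then show ?case by simp
next
  case (pCons a p)
  let ?q = "CARD('a)"
  have add: "(u + v) ^ ?q = u ^ ?q + v ^ ?q" for u v :: "'a poly"
  proof -
    have "(u + v) ^ ?q = (\<Sum>i\<le>?q. of_nat (?q choose i) * u ^ i * v ^ (?q - i))"
      by (rule binomial_ring)
    also have "{..?q} = insert 0 (insert ?q {0<..<?q})" by auto
    also have "(\<Sum>i\<in>\<dots>. of_nat (?q choose i) * u ^ i * v ^ (?q - i)) = v ^ ?q + u ^ ?q"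
      by (simp add: of_nat_poly of_nat_card_choose_eq_0)
    finally show ?thesis by simp
  qed
  have "pCons a p = [:a:] + monom 1 1 * p" by (simp add: monom_altdef)
  then have "pCons a p ^ ?q = [:a:] ^ ?q + monom 1 1 ^ ?q * p ^ ?q"
    by (simp add: add power_mult_distrib)
  also have "[:a:] ^ ?q = [:a:]" by (simp add: poly_const_pow power_card_eq_same)
  also have "monom 1 1 ^ ?q = (monom 1 ?q :: 'a poly)" by (simp add: monom_power)
  finally show ?case by (simp add: pcompose_pCons pCons.IH)
qed

text \<open>The coefficients of \<open>p\<close> reappear unchanged with zeros in between; hence
  q-th powers do not raise the degree in these coefficients.\<close>

lemma coeff_poly_power_card:
  fixes p :: "'a::{field, finite} poly"
  shows "coeff (p ^ CARD('a)) i = (if CARD('a) dvd i then coeff p (i div CARD('a)) else 0)"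
  unfolding poly_power_card
proof (induction p arbitrary: i)
  case (pCons a p)
  let ?q = "CARD('a)"
  have q: "?q > 0" by simp
  show ?case
  proof (cases "i < ?q")
    case True
    then show ?thesis using q
      by (auto simp: pcompose_pCons coeff_pCons coeff_monom_mult split: nat.splits dest: dvd_imp_le)
  next
    case False
    then obtain j where "i = ?q + j" using le_Suc_ex not_less by blast
    then show ?thesis using q
      by (auto simp: pcompose_pCons coeff_pCons coeff_monom_mult pCons.IH div_add_self1 split: nat.splits)
  qed
qed simp

section \<open>Functions of bounded degree\<close>

text \<open>Polynomials in \<open>m\<close> variables are treated as functions. The bound
  \<open>d\<close> refers to some representation by monomials, whose exponents need not be reduced
  below q.\<close>

inductive deg_le :: "nat \<Rightarrow> nat \<Rightarrow> ((nat \<Rightarrow> 'a::comm_semiring_1) \<Rightarrow> 'a) \<Rightarrow> bool" for m d where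
  monomial: "(\<Sum>i<m. e i) \<le> d \<Longrightarrow> deg_le m d (\<lambda>b. c * (\<Prod>i<m. b i ^ e i))"
| add: "deg_le m d f \<Longrightarrow> deg_le m d g \<Longrightarrow> deg_le m d (\<lambda>b. f b + g b)"

lemma deg_le_const: "deg_le m d (\<lambda>_. c)"
  using deg_le.monomial[where m = m and e = "\<lambda>_. 0" and c = c] by simp

lemma deg_le_mono:
  assumes "deg_le m d f" "d \<le> d'"
  shows "deg_le m d' f"
  using assms by induction (auto intro: deg_le.intros)

lemma deg_le_sum:
  "(\<And>x. x \<in> S \<Longrightarrow> deg_le m d (f x)) \<Longrightarrow> deg_le m d (\<lambda>b. \<Sum>x\<in>S. f x b)"
  by (induction S rule: infinite_finite_induct) (auto intro: deg_le_const deg_le.add)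

lemma deg_le_mult:
  assumes f: "deg_le m d f" and g: "deg_le m d' g"
  shows "deg_le m (d + d') (\<lambda>b. f b * g b)"
  using f
proof induction
  case (monomial e c)
  note e = this
  from g show ?case
  proof induction
    case (monomial e' c')
    have "deg_le m (d + d') (\<lambda>b. (c * c') * (\<Prod>i<m. b i ^ (e i + e' i)))"
      using e monomial by (intro deg_le.monomial) (simp add: sum.distrib add_mono)
    then show ?case by (simp add: power_add prod.distrib mult_ac)
  next
    case (add f g)
    then show ?case by (simp add: distrib_left deg_le.add)
  qed
next
  case (add f g)
  then show ?case by (simp add: distrib_right deg_le.add)
qed

lemma deg_le_cmult: "deg_le m d f \<Longrightarrow> deg_le m d (\<lambda>b. c * f b)"
  using deg_le_mult[OF deg_le_const[where d = 0 and c = c]] by fastforce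

lemma deg_le_power: "deg_le m d f \<Longrightarrow> deg_le m (d * j) (\<lambda>b. f b ^ j)"
  by (induction j) (auto intro: deg_le_const deg_le_mult)

lemma deg_le_prod:
  "(\<And>x. x \<in> S \<Longrightarrow> deg_le m (d x) (f x)) \<Longrightarrow> deg_le m (\<Sum>x\<in>S. d x) (\<lambda>b. \<Prod>x\<in>S. f x b)"
  by (induction S rule: infinite_finite_induct) (auto intro: deg_le_const deg_le_mult)

lemma deg_le_var:
  assumes "i < m"
  shows "deg_le m 1 (\<lambda>b :: nat \<Rightarrow> 'a::comm_semiring_1. b i)"
proof -
  have "deg_le m 1 (\<lambda>b :: nat \<Rightarrow> 'a. 1 * (\<Prod>j<m. b j ^ (if j = i then 1 else 0)))"
    using assms by (intro deg_le.monomial) simp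
  also have "(\<lambda>b :: nat \<Rightarrow> 'a. 1 * (\<Prod>j<m. b j ^ (if j = i then 1 else 0))) = (\<lambda>b. b i)"
  proof
    fix b :: "nat \<Rightarrow> 'a"
    have "(\<Prod>j<m. b j ^ (if j = i then 1 else 0)) = (\<Prod>j<m. if j = i then b j else 1)"
      by (rule prod.cong) auto
    then show "1 * (\<Prod>j<m. b j ^ (if j = i then 1 else 0)) = b i" using assms by simp
  qed
  finally show ?thesis .
qed

text \<open>A monomial of total degree below m(q - 1) has an exponent below q - 1. Its sum over all
  points factors over the coordinates, and the factor of that exponent is 0.\<close>

lemma sum_deg_le_eq_0:
  fixes f :: "(nat \<Rightarrow> 'a::{field, finite}) \<Rightarrow> 'a"
  assumes "deg_le m d f" "d < m * (CARD('a) - 1)"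
  shows "(\<Sum>b\<in>{..<m} \<rightarrow>\<^sub>E UNIV. f b) = 0"
  using assms(1)
proof induction
  case (monomial e c)
  have "\<exists>i<m. e i < CARD('a) - 1"
  proof (rule ccontr)
    assume "\<not> ?thesis"
    then have "(\<Sum>i<m. CARD('a) - 1) \<le> (\<Sum>i<m. e i)"
      by (intro sum_mono) (meson lessThan_iff not_less)
    then show False using monomial assms(2) by simp
  qed
  then obtain i where i: "i < m" "e i < CARD('a) - 1" by blast
  have "(\<Sum>b\<in>{..<m} \<rightarrow>\<^sub>E UNIV. c * (\<Prod>i<m. b i ^ e i)) = c * (\<Prod>i<m. \<Sum>x\<in>(UNIV :: 'a set). x ^ e i)"
    by (subst prod_sum_PiE) (auto simp: sum_distrib_left)
  also have "(\<Prod>i<m. \<Sum>x\<in>(UNIV :: 'a set). x ^ e i) = 0"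
    using i sum_power_eq_0[OF i(2)] by (intro prod_zero) auto
  finally show ?case by simp
next
  case (add f g)
  then show ?case by (simp add: sum.distrib)
qed

text \<open>Here \<open>d\<close> bounds the degree in the variables \<open>b\<close>, not the
  degree in the indeterminate.\<close>

definition poly_deg_le :: "nat \<Rightarrow> nat \<Rightarrow> ((nat \<Rightarrow> 'a::comm_semiring_1) \<Rightarrow> 'a poly) \<Rightarrow> bool" where
  "poly_deg_le m d P \<longleftrightarrow> (\<forall>i. deg_le m d (\<lambda>b. coeff (P b) i))"

lemma poly_deg_le_mult:
  assumes "poly_deg_le m d P" "poly_deg_le m d' Q"
  shows "poly_deg_le m (d + d') (\<lambda>b. P b * Q b)"
  using assms unfolding poly_deg_le_def coeff_mult by (auto intro!: deg_le_sum deg_le_mult)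

lemma poly_deg_le_power:
  assumes "poly_deg_le m d P"
  shows "poly_deg_le m (d * j) (\<lambda>b. P b ^ j)"
proof (induction j)
  case 0
  then show ?case by (simp add: poly_deg_le_def deg_le_const)
next
  case (Suc j)
  then show ?case using poly_deg_le_mult[OF assms Suc] by simp
qed

lemma poly_deg_le_power_card:
  fixes P :: "(nat \<Rightarrow> 'a::{field, finite}) \<Rightarrow> 'a poly"
  assumes "poly_deg_le m d P"
  shows "poly_deg_le m d (\<lambda>b. P b ^ CARD('a))"
  unfolding poly_deg_le_def
proof
  fix i
  show "deg_le m d (\<lambda>b. coeff (P b ^ CARD('a)) i)"
    using assms by (cases "CARD('a) dvd i") (simp_all add: poly_deg_le_def coeff_poly_power_card deg_le_const)
qed

text \<open>Raising to the power \<open>q\<close> is linear, so only the base-\<open>q\<close> digits of the exponent count.\<close>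
lemma poly_deg_le_power_digits:
  fixes P :: "(nat \<Rightarrow> 'a::{field, finite}) \<Rightarrow> 'a poly"
  assumes "poly_deg_le m 1 P" "j < CARD('a) ^ L"
  shows "poly_deg_le m (L * (CARD('a) - 1)) (\<lambda>b. P b ^ j)"
  using assms
proof (induction L arbitrary: P j)
  case 0
  then show ?case by (simp add: poly_deg_le_def deg_le_const)
next
  case (Suc L)
  let ?q = "CARD('a)"
  \<comment> \<open>The lowest digit of \<open>j\<close> is split off. The q-th power of
    \<open>P\<close> still has degree bound 1, so the induction hypothesis applies to it and the
    remaining \<open>L\<close> digits.\<close>
  have "j div ?q < ?q ^ L"
    using Suc.prems(2) by (simp add: less_mult_imp_div_less mult.commute)
  then have 1: "poly_deg_le m (L * (?q - 1)) (\<lambda>b. (P b ^ ?q) ^ (j div ?q))"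
    by (intro Suc.IH poly_deg_le_power_card Suc.prems)
  have 2: "poly_deg_le m (j mod ?q) (\<lambda>b. P b ^ (j mod ?q))"
    using poly_deg_le_power[OF Suc.prems(1)] by simp
  have "j mod ?q < ?q" by simp
  then have "j mod ?q \<le> ?q - 1" by linarith
  with 2 have 2: "poly_deg_le m (?q - 1) (\<lambda>b. P b ^ (j mod ?q))"
    by (auto simp: poly_deg_le_def intro: deg_le_mono)
  have "P b ^ (j mod ?q) * (P b ^ ?q) ^ (j div ?q) = P b ^ j" for b
    by (simp flip: power_mult power_add)
  with poly_deg_le_mult[OF 2 1] show ?case by simp
qed

lemma poly_deg_le_pcompose:
  fixes P :: "(nat \<Rightarrow> 'a::{field, finite}) \<Rightarrow> 'a poly"
  assumes "poly_deg_le m 1 P" "degree F < CARD('a) ^ L"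
  shows "poly_deg_le m (L * (CARD('a) - 1)) (\<lambda>b. pcompose F (P b))"
proof -
  have "pcompose F p = (\<Sum>j\<le>degree F. smult (coeff F j) (p ^ j))" for p :: "'a poly"
    by (simp add: pcompose_altdef poly_altdef coeff_map_poly degree_map_poly)
  moreover have "poly_deg_le m (L * (CARD('a) - 1)) (\<lambda>b. P b ^ j)" if "j \<le> degree F" for j
    using that assms by (intro poly_deg_le_power_digits) auto
  ultimately show ?thesis
    by (auto simp: poly_deg_le_def coeff_sum intro!: deg_le_sum deg_le_cmult)
qed


section \<open>Indicator functions as polynomials\<close>

text \<open>For j < q this is the coefficient of x^j in 1 - (x - y)^(q - 1), the indicator of x =
  y.\<close>

definition delta_coeff :: "nat \<Rightarrow> 'a \<Rightarrow> 'a::{field, finite}" where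
  "delta_coeff j y = of_bool (j = 0) -
     of_nat (CARD('a) - 1 choose j) * (-1) ^ (CARD('a) - 1 - j) * y ^ (CARD('a) - 1 - j)"

lemma of_bool_eq_sum_delta_coeff:
  fixes x y :: "'a::{field, finite}"
  shows "of_bool (x = y) = (\<Sum>j<CARD('a). delta_coeff j y * x ^ j)"
proof -
  let ?q = "CARD('a)"
  have "{..<?q} = {..?q - 1}"
    using CARD_ge_2[where 'a = 'a] by auto
  moreover have "(- y) ^ l = (- 1) ^ l * y ^ l" for l
    by (rule power_minus)
  ultimately have "(\<Sum>j<?q. delta_coeff j y * x ^ j) = (\<Sum>j\<le>?q - 1. of_bool (j = 0) * x ^ j) -
      (\<Sum>j\<le>?q - 1. of_nat (?q - 1 choose j) * x ^ j * (- y) ^ (?q - 1 - j))"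
    by (simp add: delta_coeff_def algebra_simps sum_subtractf)
  also have "(\<Sum>j\<le>?q - 1. of_bool (j = 0) * x ^ j) = (\<Sum>j\<le>?q - 1. of_bool (j = 0))"
    by (rule sum.cong) (simp_all add: of_bool_def)
  also have "\<dots> = 1" by (simp add: of_bool_def)
  also have "(\<Sum>j\<le>?q - 1. of_nat (?q - 1 choose j) * x ^ j * (- y) ^ (?q - 1 - j)) = (x + - y) ^ (?q - 1)"
    by (rule binomial_ring[symmetric])
  also have "1 - \<dots> = of_bool (x = y)"
    using power_card_minus_one[of "x - y"] by simp
  finally show ?thesis by simp
qed

text \<open>A factor x^j in the indicator leaves degree at most q - 1 - j for y. This trade turns a
  lower bound on the degree in \<open>b\<close> into an upper bound on the degree in the other
  variables.\<close>

lemma deg_le_delta_coeff: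
  fixes Y :: "(nat \<Rightarrow> 'a::{field, finite}) \<Rightarrow> 'a"
  assumes "deg_le m D Y"
  shows "deg_le m (D * (CARD('a) - 1 - j)) (\<lambda>b. delta_coeff j (Y b))"
proof -
  let ?r = "CARD('a) - 1 - j"
  have "deg_le m (D * ?r) (\<lambda>b. of_bool (j = 0) +
          (- (of_nat (CARD('a) - 1 choose j) * (-1) ^ ?r)) * Y b ^ ?r)"
    by (intro deg_le.add deg_le_const deg_le_cmult deg_le_power assms)
  then show ?thesis by (simp add: delta_coeff_def)
qed

text \<open>The product of the \<open>n\<close> indicators is expanded in monomials in
  \<open>z\<close>. Each coefficient \<open>c e\<close> is a sum over all \<open>b\<close> of a
  function of degree at most \<open>D * (\<Sum>i<n. CARD('a) - 1 - e i)\<close>, so it vanishes when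
  this is below m(q - 1).\<close>

lemma count_solutions_polynomial:
  fixes Y :: "nat \<Rightarrow> (nat \<Rightarrow> 'a::{field, finite}) \<Rightarrow> 'a"
  assumes "\<And>i. deg_le m D (Y i)"
  obtains c where
    "\<And>z. (\<Sum>b\<in>{..<m} \<rightarrow>\<^sub>E UNIV. of_bool (\<forall>i<n. z i = Y i b)) =
         (\<Sum>e\<in>{..<n} \<rightarrow>\<^sub>E {..<CARD('a)}. c e * (\<Prod>i<n. z i ^ e i))"
    "\<And>e. c e \<noteq> 0 \<Longrightarrow> m * (CARD('a) - 1) \<le> D * (\<Sum>i<n. CARD('a) - 1 - e i)"
proof
  let ?q = "CARD('a)" and ?B = "{..<m} \<rightarrow>\<^sub>E (UNIV :: 'a set)" and ?E = "{..<n} \<rightarrow>\<^sub>E {..<CARD('a)}"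
  define c where "c e = (\<Sum>b\<in>?B. \<Prod>i<n. delta_coeff (e i) (Y i b))" for e
  have "of_bool (\<forall>i<n. z i = Y i b) = (\<Prod>i<n. of_bool (z i = Y i b) :: 'a)" for z b
    by (induction n) (auto simp: less_Suc_eq)
  also have "\<dots> z b = (\<Sum>e\<in>?E. (\<Prod>i<n. delta_coeff (e i) (Y i b)) * (\<Prod>i<n. z i ^ e i))" for z b
    by (simp add: of_bool_eq_sum_delta_coeff prod_sum_PiE prod.distrib)
  finally have *: "of_bool (\<forall>i<n. z i = Y i b) =
      (\<Sum>e\<in>?E. (\<Prod>i<n. delta_coeff (e i) (Y i b)) * (\<Prod>i<n. z i ^ e i))" for z b .
  show "(\<Sum>b\<in>?B. of_bool (\<forall>i<n. z i = Y i b)) = (\<Sum>e\<in>?E. c e * (\<Prod>i<n. z i ^ e i))" for z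
    unfolding * c_def sum_distrib_right by (rule sum.swap)
  show "m * (?q - 1) \<le> D * (\<Sum>i<n. ?q - 1 - e i)" if "c e \<noteq> 0" for e
  proof (rule ccontr)
    assume "\<not> ?thesis"
    moreover have "deg_le m (\<Sum>i<n. D * (?q - 1 - e i)) (\<lambda>b. \<Prod>i<n. delta_coeff (e i) (Y i b))"
      by (intro deg_le_prod deg_le_delta_coeff assms)
    ultimately have "c e = 0"
      unfolding c_def by (intro sum_deg_le_eq_0) (auto simp: sum_distrib_left)
    with that show False by simp
  qed
qed

section \<open>The rank argument\<close>

text \<open>Rank is replaced by counting: the matrix \<open>\<alpha>\<close> induces an injection from \<open>'a\<^sup>A\<close> to \<open>'a\<^sup>T\<close>.\<close>
lemma card_le_if_diagonal_factorization:
  fixes \<alpha> :: "'t \<Rightarrow> 'x \<Rightarrow> 'a::{field, finite}"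
  assumes "finite A" "finite T" "c \<noteq> 0"
    and diag: "\<And>x y. x \<in> A \<Longrightarrow> y \<in> A \<Longrightarrow> (\<Sum>t\<in>T. \<alpha> t x * \<beta> t y) = (if x = y then c else 0)"
  shows "card A \<le> card T"
proof -
  define \<phi> where "\<phi> w = (\<lambda>t\<in>T. \<Sum>x\<in>A. w x * \<alpha> t x)" for w :: "'x \<Rightarrow> 'a"
  \<comment> \<open>Pairing with \<beta> isolates one coordinate of \<open>w\<close>, scaled by
    \<open>c\<close>, so \<phi> is injective.\<close>
  have recover: "(\<Sum>t\<in>T. \<phi> w t * \<beta> t y) = w y * c" if "y \<in> A" for w y
  proof -
    have "(\<Sum>t\<in>T. \<phi> w t * \<beta> t y) = (\<Sum>t\<in>T. \<Sum>x\<in>A. w x * (\<alpha> t x * \<beta> t y))"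
      by (simp add: \<phi>_def sum_distrib_right mult.assoc)
    also have "\<dots> = (\<Sum>x\<in>A. w x * (\<Sum>t\<in>T. \<alpha> t x * \<beta> t y))"
      by (subst sum.swap) (simp add: sum_distrib_left)
    also have "\<dots> = (\<Sum>x\<in>A. if x = y then w x * c else 0)"
      using that by (intro sum.cong) (auto simp: diag)
    finally show ?thesis using that assms by simp
  qed
  have "inj_on \<phi> (A \<rightarrow>\<^sub>E UNIV)"
  proof
    fix w w' assume w: "w \<in> A \<rightarrow>\<^sub>E UNIV" "w' \<in> A \<rightarrow>\<^sub>E UNIV" "\<phi> w = \<phi> w'"
    show "w = w'"
    proof (rule PiE_ext[OF w(1,2)])
      fix y assume "y \<in> A"
      then show "w y = w' y" using recover[of y w] recover[of y w'] w(3) \<open>c \<noteq> 0\<close> by simp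
    qed
  qed
  then have "card (A \<rightarrow>\<^sub>E (UNIV :: 'a set)) \<le> card (T \<rightarrow>\<^sub>E (UNIV :: 'a set))"
    using assms by (intro card_inj_on_le[of \<phi>]) (auto simp: \<phi>_def finite_PiE)
  then have "CARD('a) ^ card A \<le> CARD('a) ^ card T"
    using assms by (simp add: card_funcsetE)
  then show ?thesis using CARD_ge_2[where 'a = 'a] by (simp add: power_increasing_iff)
qed

text \<open>Each monomial in the expansion has an exponent \<open>u\<close> in \<open>X x\<close>
  and \<open>e - u\<close> in \<open>X y\<close>, and one of the two has size at most
  \<open>R\<close>. Grouping by that exponent writes the matrix as a sum of 2|S| products of a
  function of x and a function of y.\<close>

lemma croot_lev_pach:
  fixes X :: "'x \<Rightarrow> nat \<Rightarrow> 'a::{field, finite}" and c :: "(nat \<Rightarrow> nat) \<Rightarrow> 'a" and n :: nat and R :: real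
  defines "E \<equiv> {..<n} \<rightarrow>\<^sub>E {..<CARD('a)}"
  defines "S \<equiv> {u \<in> E. real (\<Sum>i<n. u i) \<le> R}"
  assumes "finite A" "d \<noteq> 0"
    and deg: "\<And>e. e \<in> E \<Longrightarrow> c e \<noteq> 0 \<Longrightarrow> real (\<Sum>i<n. e i) \<le> 2 * R"
    and diag: "\<And>x y. x \<in> A \<Longrightarrow> y \<in> A \<Longrightarrow>
      (\<Sum>e\<in>E. c e * (\<Prod>i<n. (X x i - X y i) ^ e i)) = (if x = y then d else 0)"
  shows "card A \<le> 2 * card S"
proof -
  have fin: "finite E" "finite S"
    by (auto simp: E_def S_def intro!: finite_PiE)
  \<comment> \<open>\<open>M\<close> is the term with exponent \<open>u\<close> in
    \<open>X x\<close>; \<open>v\<close> below is the complementary exponent, in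
    \<open>X y\<close>.\<close>
  define M where "M x y = (\<lambda>(e, u). c e * (\<Prod>i<n. of_nat (e i choose u i)) *
      ((\<Prod>i<n. X x i ^ u i) * (\<Prod>i<n. (- X y i) ^ (e i - u i))))" for x y
  define v where "v = (\<lambda>(e, u). \<lambda>i\<in>{..<n}. e i - u i :: nat)"
  \<comment> \<open>These are the terms whose exponent in \<open>X x\<close> is too large. As
    subtraction is truncated, \<open>v\<close> complements \<open>u\<close> only if u \<le> e
    pointwise; otherwise a binomial coefficient makes the term 0.\<close>
  define P where "P = {(e, u). e \<in> E \<and> u \<in> E - S \<and> c e \<noteq> 0 \<and> (\<forall>i<n. u i \<le> e i)}"
  have finP: "finite P"
    by (rule finite_subset[of _ "E \<times> E"]) (auto simp: P_def fin)
  have expand: "c e * (\<Prod>i<n. (X x i - X y i) ^ e i) = (\<Sum>u\<in>E. M x y (e, u))"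
    if "e \<in> E" for e x y
  proof -
    have "(X x i - X y i) ^ e i =
        (\<Sum>u<CARD('a). of_nat (e i choose u) * X x i ^ u * (- X y i) ^ (e i - u))" if "i < n" for i
    proof -
      have "e i < CARD('a)" using \<open>e \<in> E\<close> that by (auto simp: E_def)
      have "(X x i - X y i) ^ e i = (X x i + - X y i) ^ e i" by simp
      also have "\<dots> = (\<Sum>u\<le>e i. of_nat (e i choose u) * X x i ^ u * (- X y i) ^ (e i - u))"
        by (rule binomial_ring)
      also have "\<dots> = (\<Sum>u<CARD('a). of_nat (e i choose u) * X x i ^ u * (- X y i) ^ (e i - u))"
        using \<open>e i < CARD('a)\<close> by (intro sum.mono_neutral_left) (auto simp: binomial_eq_0)
      finally show ?thesis .
    qed
    then have "(\<Prod>i<n. (X x i - X y i) ^ e i) =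
        (\<Prod>i<n. \<Sum>u<CARD('a). of_nat (e i choose u) * X x i ^ u * (- X y i) ^ (e i - u))"
      by (intro prod.cong) auto
    also have "\<dots> = (\<Sum>u\<in>E. \<Prod>i<n. of_nat (e i choose u i) * X x i ^ u i * (- X y i) ^ (e i - u i))"
      unfolding E_def by (rule prod_sum_PiE) auto
    finally show ?thesis by (simp add: M_def sum_distrib_left prod.distrib mult_ac)
  qed
  have v_in: "v p \<in> S" if "p \<in> P" for p
  proof -
    obtain e u where p: "p = (e, u)" "e \<in> E" "u \<in> E" "u \<notin> S" "c e \<noteq> 0" "\<forall>i<n. u i \<le> e i"
      using \<open>p \<in> P\<close> by (auto simp: P_def)
    have "(\<Sum>i<n. e i) = (\<Sum>i<n. u i) + (\<Sum>i<n. v p i)"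
      unfolding sum.distrib[symmetric] using p by (intro sum.cong) (auto simp: v_def)
    moreover have "real (\<Sum>i<n. u i) > R" using p by (auto simp: S_def)
    moreover have "real (\<Sum>i<n. e i) \<le> 2 * R" using p deg by blast
    ultimately have "real (\<Sum>i<n. v p i) \<le> R" by simp
    moreover have "v p \<in> E" using p by (auto simp: v_def E_def PiE_iff less_imp_diff_less)
    ultimately show ?thesis by (simp add: S_def)
  qed
  \<comment> \<open>The flag tells which side carries the small exponent \<open>u\<close>: for
    \<open>True\<close> it is \<open>X x\<close> and \<beta> gathers the rest, for
    \<open>False\<close> it is \<open>X y\<close> and \<alpha> gathers all terms of \<open>P\<close>
    with complement \<open>u\<close>.\<close>
  define \<alpha> where "\<alpha> = (\<lambda>(s, u) x. if s then \<Prod>i<n. X x i ^ u i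
    else \<Sum>(e, u')\<in>{p \<in> P. v p = u}. c e * (\<Prod>i<n. of_nat (e i choose u' i)) * (\<Prod>i<n. X x i ^ u' i))"
  define \<beta> where "\<beta> = (\<lambda>(s, u) y. if s
    then \<Sum>e\<in>E. c e * (\<Prod>i<n. of_nat (e i choose u i)) * (\<Prod>i<n. (- X y i) ^ (e i - u i))
    else \<Prod>i<n. (- X y i) ^ u i)"
  have factor: "(\<Sum>t\<in>UNIV \<times> S. \<alpha> t x * \<beta> t y) = (\<Sum>e\<in>E. c e * (\<Prod>i<n. (X x i - X y i) ^ e i))" for x y
  proof -
    have "(\<Sum>u\<in>S. \<alpha> (True, u) x * \<beta> (True, u) y) = (\<Sum>u\<in>S. \<Sum>e\<in>E. M x y (e, u))"
      by (simp add: \<alpha>_def \<beta>_def M_def sum_distrib_left mult_ac)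
    also have "\<dots> = (\<Sum>e\<in>E. \<Sum>u\<in>S. M x y (e, u))" by (rule sum.swap)
    finally have 1: "(\<Sum>u\<in>S. \<alpha> (True, u) x * \<beta> (True, u) y) = (\<Sum>e\<in>E. \<Sum>u\<in>S. M x y (e, u))" .
    have "\<alpha> (False, w) x * \<beta> (False, w) y = (\<Sum>p\<in>{p \<in> P. v p = w}. M x y p)" for w
    proof -
      have "(\<Prod>i<n. (- X y i) ^ (e i - u i)) = (\<Prod>i<n. (- X y i) ^ w i)" if "v (e, u) = w" for e u
        using that by (intro prod.cong) (auto simp: v_def)
      then show ?thesis
        unfolding \<alpha>_def \<beta>_def M_def
        by (auto simp: sum_distrib_right mult.assoc intro!: sum.cong)
    qed
    then have "(\<Sum>w\<in>S. \<alpha> (False, w) x * \<beta> (False, w) y) = (\<Sum>w\<in>S. \<Sum>p\<in>{p \<in> P. v p = w}. M x y p)"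
      by simp
    also have "\<dots> = (\<Sum>p\<in>P. M x y p)"
      using v_in by (intro sum.group finP fin) auto
    also have "\<dots> = (\<Sum>p\<in>E \<times> (E - S). M x y p)"
    proof (intro sum.mono_neutral_left ballI)
      fix p assume p_in: "p \<in> E \<times> (E - S) - P"
      obtain e u where p: "p = (e, u)" by (cases p)
      then have "c e = 0 \<or> (\<exists>i<n. e i < u i)"
        using p_in by (simp add: P_def) (meson not_le)
      moreover have "(\<Prod>i<n. of_nat (e i choose u i)) = (0 :: 'a)" if i: "i < n" "e i < u i" for i
      proof (rule prod_zero)
        have "of_nat (e i choose u i) = (0 :: 'a)" by (simp only: binomial_eq_0[OF i(2)] of_nat_0)
        then show "\<exists>i\<in>{..<n}. of_nat (e i choose u i) = (0 :: 'a)" using i(1) by blast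
      qed simp
      ultimately have "c e * (\<Prod>i<n. of_nat (e i choose u i)) = 0"
        by (metis mult_zero_left mult_zero_right)
      then show "M x y p = 0" unfolding p M_def prod.case by (simp only: mult_zero_left)
    qed (auto simp: fin P_def)
    also have "\<dots> = (\<Sum>e\<in>E. \<Sum>u\<in>E - S. M x y (e, u))"
      by (simp add: sum.cartesian_product)
    finally have 2: "(\<Sum>w\<in>S. \<alpha> (False, w) x * \<beta> (False, w) y) = (\<Sum>e\<in>E. \<Sum>u\<in>E - S. M x y (e, u))" .
    have "(\<Sum>t\<in>UNIV \<times> S. \<alpha> t x * \<beta> t y) =
        (\<Sum>u\<in>S. \<alpha> (True, u) x * \<beta> (True, u) y) + (\<Sum>w\<in>S. \<alpha> (False, w) x * \<beta> (False, w) y)"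
      by (simp add: sum.cartesian_product' UNIV_bool add.commute)
    also have "\<dots> = (\<Sum>e\<in>E. \<Sum>u\<in>E. M x y (e, u))"
    proof -
      have "S \<subseteq> E" by (simp add: S_def)
      have "(\<Sum>u\<in>S. M x y (e, u)) + (\<Sum>u\<in>E - S. M x y (e, u)) = (\<Sum>u\<in>E. M x y (e, u))" for e
        by (subst add.commute) (rule sum.subset_diff[OF \<open>S \<subseteq> E\<close> fin(1), symmetric])
      then show ?thesis unfolding 1 2 by (simp flip: sum.distrib)
    qed
    finally show ?thesis by (simp add: expand)
  qed
  have "card A \<le> card ((UNIV :: bool set) \<times> S)"
    using assms(3,4) fin
    by (intro card_le_if_diagonal_factorization[where \<alpha> = \<alpha> and \<beta> = \<beta> and c = d])
      (auto simp: factor diag)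
  then show ?thesis by (simp add: card_cartesian_product)
qed

section \<open>Counting monomials of small degree\<close>

text \<open>This is Hoeffding's lemma for a fair sign: since cosh is even,
  \<open>\<bar>x\<bar>\<close> may be used, and the step \<open>2 * \<bar>x\<bar>\<close> is taken
  with probability 1/2.\<close>

lemma cosh_le_exp_square_half: "cosh x \<le> exp (x\<^sup>2 / 2)" for x :: real
proof -
  have "cosh \<bar>x\<bar> = exp (- \<bar>x\<bar>) * (1 + 1 / 2 * (exp (2 * \<bar>x\<bar>) - 1))"
    by (simp add: cosh_field_def field_simps flip: exp_add)
  also have "\<dots> = exp (- (2 * \<bar>x\<bar>) * (1 / 2) + ln (1 + 1 / 2 * (exp (2 * \<bar>x\<bar>) - 1)))"
    by (subst exp_add, subst exp_ln) (auto simp: add_pos_nonneg)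
  also have "\<dots> \<le> exp ((2 * \<bar>x\<bar>)\<^sup>2 / 8)"
    using Hoeffdings_lemma_aux[of "2 * \<bar>x\<bar>" "1 / 2"] by simp
  finally show ?thesis by (simp add: power_mult_distrib)
qed

text \<open>This bounds the moment generating function of a uniform exponent. The reflection j -> q
  - 1 - j symmetrises each exponential into a cosh, and no deviation exceeds (q - 1)/2.\<close>

lemma sum_exp_centred_le:
  fixes l :: real
  assumes "q \<ge> 1"
  shows "(\<Sum>j<q. exp (l * ((real q - 1) / 2 - real j))) \<le> real q * exp (l\<^sup>2 * (real q - 1)\<^sup>2 / 8)"
proof -
  let ?f = "\<lambda>j. l * ((real q - 1) / 2 - real j)"
  have "(\<Sum>j<q. exp (?f j)) = (\<Sum>j<q. exp (- ?f j))"
    by (rule sum.reindex_bij_witness[of _ "\<lambda>j. q - 1 - j" "\<lambda>j. q - 1 - j"])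
      (auto simp: of_nat_diff field_simps)
  then have "(\<Sum>j<q. exp (?f j)) = (\<Sum>j<q. cosh (?f j))"
    by (simp add: cosh_field_def sum.distrib flip: sum_divide_distrib)
  also have "\<dots> \<le> (\<Sum>j<q. exp (l\<^sup>2 * (real q - 1)\<^sup>2 / 8))"
  proof (rule sum_mono)
    fix j assume "j \<in> {..<q}"
    then have "real j \<le> real q - 1" by auto
    then have "((real q - 1) / 2 - real j)\<^sup>2 \<le> ((real q - 1) / 2)\<^sup>2"
      by (intro abs_le_square_iff[THEN iffD1]) (auto simp: abs_if field_simps)
    then have "(?f j)\<^sup>2 / 2 \<le> l\<^sup>2 * (real q - 1)\<^sup>2 / 8"
      using mult_left_mono[of _ _ "l\<^sup>2"] by (fastforce simp: power_mult_distrib power_divide)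
    then show "cosh (?f j) \<le> exp (l\<^sup>2 * (real q - 1)\<^sup>2 / 8)"
      by (intro order.trans[OF cosh_le_exp_square_half]) simp
  qed
  finally show ?thesis by simp
qed

text \<open>Chernoff's method: on \<open>?S\<close> the exponential weight is at least 1, and its
  sum over all exponent vectors factors over the coordinates.\<close>

lemma card_small_degree_le:
  fixes t :: real
  assumes "n \<ge> 1" "q \<ge> 2" "t \<ge> 0"
  shows "real (card {u \<in> {..<n} \<rightarrow>\<^sub>E {..<q}. real (\<Sum>i<n. u i) \<le> real n * (real q - 1) / 2 - t})
    \<le> real q ^ n * exp (- 2 * t\<^sup>2 / (real n * (real q - 1)\<^sup>2))" (is "real (card ?S) \<le> _")
proof -
  \<comment> \<open>This value minimises the final exponent n l^2 (q - 1)^2 / 8 - l t.\<close>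
  define l where "l = 4 * t / (real n * (real q - 1)\<^sup>2)"
  have l: "l \<ge> 0" using assms by (simp add: l_def)
  let ?E = "{..<n} \<rightarrow>\<^sub>E {..<q}"
  have split: "exp (l * (real n * (real q - 1) / 2 - t - real (\<Sum>i<n. u i))) =
      exp (- l * t) * (\<Prod>i<n. exp (l * ((real q - 1) / 2 - real (u i))))" for u
    by (simp add: sum_subtractf algebra_simps flip: exp_sum exp_add sum_distrib_left)
  have "real (card ?S) = (\<Sum>u\<in>?S. 1)" by simp
  also have "\<dots> \<le> (\<Sum>u\<in>?S. exp (l * (real n * (real q - 1) / 2 - t - real (\<Sum>i<n. u i))))"
    using l by (intro sum_mono) auto
  also have "\<dots> \<le> (\<Sum>u\<in>?E. exp (l * (real n * (real q - 1) / 2 - t - real (\<Sum>i<n. u i))))"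
    by (intro sum_mono2) (auto intro!: finite_PiE)
  also have "\<dots> = exp (- l * t) * (\<Prod>i<n. \<Sum>j<q. exp (l * ((real q - 1) / 2 - real j)))"
    unfolding split by (subst prod_sum_PiE) (auto simp: sum_distrib_left)
  also have "\<dots> \<le> exp (- l * t) * (real q * exp (l\<^sup>2 * (real q - 1)\<^sup>2 / 8)) ^ n"
    using sum_exp_centred_le[of q l] assms by (auto intro!: mult_left_mono power_mono sum_nonneg)
  also have "\<dots> = real q ^ n * exp (real n * (l\<^sup>2 * (real q - 1)\<^sup>2 / 8) - l * t)"
    unfolding power_mult_distrib exp_of_nat_mult[symmetric] by (simp add: diff_conv_add_uminus exp_add mult_ac del: add_uminus_conv_diff)
  also have "real n * (l\<^sup>2 * (real q - 1)\<^sup>2 / 8) - l * t = - 2 * t\<^sup>2 / (real n * (real q - 1)\<^sup>2)"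
  proof -
    define s where "s = real q - 1"
    have "s > 0" "real n > 0" using assms by (auto simp: s_def)
    then show ?thesis
      unfolding l_def s_def[symmetric] by (simp add: field_simps power2_eq_square)
  qed
  finally show ?thesis .
qed


section \<open>The theorem\<close>

lemma coeff_sum_monom_lessThan:
  "coeff (\<Sum>j<m. monom (b j) j) i = (if i < m then b i else 0)"
  by (simp add: coeff_sum)

lemma coeff_polys_below: "p \<in> polys_below n \<Longrightarrow> n \<le> i \<Longrightarrow> coeff p i = 0"
  by (auto simp: polys_below_def coeff_sum_monom_lessThan)

text \<open>A nonzero \<open>F\<close> composed with a nonconstant polynomial is nonzero, so the
  solutions are exactly the constants at the roots of \<open>F\<close>.\<close>

lemma card_pcompose_zeros:
  fixes F :: "'a::{field, finite} poly"
  assumes "F \<noteq> 0" "m \<ge> 1"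
  shows "card {b \<in> {..<m} \<rightarrow>\<^sub>E UNIV. pcompose F (\<Sum>j<m. monom (b j) j) = 0} = card {x. poly F x = 0}"
proof (rule bij_betw_same_card[symmetric])
  define h :: "'a \<Rightarrow> nat \<Rightarrow> 'a" where "h x = (\<lambda>i\<in>{..<m}. if i = 0 then x else 0)" for x
  let ?P = "\<lambda>b :: nat \<Rightarrow> 'a. \<Sum>j<m. monom (b j) j"
  have h: "h x \<in> {..<m} \<rightarrow>\<^sub>E UNIV" "h x 0 = x" for x
    using assms by (simp_all add: h_def)
  have P_h: "?P (h x) = [:x:]" for x
    using assms by (intro poly_eqI) (auto simp: h_def coeff_sum_monom_lessThan coeff_pCons split: nat.splits)
  have inv: "h (b 0) = b" "poly F (b 0) = 0"
    if b: "b \<in> {..<m} \<rightarrow>\<^sub>E UNIV" "pcompose F (?P b) = 0" for b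
  proof -
    have "degree (?P b) = 0"
      using pcompose_eq_0[OF b(2)] assms by blast
    then have "b i = 0" if "0 < i" "i < m" for i
      using coeff_eq_0[of "?P b" i] that by (simp add: coeff_sum_monom_lessThan)
    then show *: "h (b 0) = b"
      by (intro PiE_ext[OF h(1) b(1)]) (auto simp: h_def)
    have "pcompose F [:b 0:] = 0" using b(2) P_h[of "b 0"] * by simp
    then show "poly F (b 0) = 0" by (simp add: pcompose_pCons_0)
  qed
  show "bij_betw h {x. poly F x = 0} {b \<in> {..<m} \<rightarrow>\<^sub>E UNIV. pcompose F (?P b) = 0}"
    by (intro bij_betw_byWitness[where f' = "\<lambda>b. b 0"])
      (use h inv in \<open>auto simp: P_h pcompose_pCons_0\<close>)
qed

theorem theorem1p2:
  fixes F :: "'a::{field, finite} poly" and A :: "'a poly set" and q k n :: nat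
  assumes "q = CARD('a)"
    and "degree F = k"
    and "coeff F 0 = 0"
    and "coprime (card {x :: 'a. poly F x = 0}) q"
    and "n \<ge> 1"
    and "A \<subseteq> polys_below n"
    and "real (card A) > 2 * real q powr ((1 - c' k q) * real n)"
  shows "\<exists>p\<in>A. \<exists>p'\<in>A. p \<noteq> p' \<and> (\<exists>b :: 'a poly. p - p' = pcompose F b)"
proof (rule ccontr)
  assume no: "\<not> ?thesis"
  have q: "q \<ge> 2" using assms(1) CARD_ge_2[where 'a = 'a] by simp
  have "F \<noteq> 0"
  proof
    assume "F = 0"
    then have "coprime q q" using assms(1,4) by simp
    then show False using q by simp
  qed
  have "k \<ge> 1"
  proof (rule ccontr)
    assume "\<not> k \<ge> 1"
    then have "F = [:coeff F 0:]" using assms(2) degree_0_id[of F] by simp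
    then show False using \<open>F \<noteq> 0\<close> assms(3) by simp
  qed
  \<comment> \<open>An infinite set has \<open>card\<close> equal to 0, which contradicts the lower
    bound on \<open>card A\<close>.\<close>
  have "finite A"
  proof (rule ccontr)
    assume "infinite A"
    then have "real (card A) = 0" by simp
    moreover have "real q powr ((1 - c' k q) * real n) \<ge> 0" by simp
    ultimately show False using assms(7) by linarith
  qed
  \<comment> \<open>The number of base-q digits of \<open>k\<close> is \<open>a + 1\<close>, and a
    \<le> log_q k.\<close>
  obtain a where a: "q ^ a \<le> k" "k < q ^ (a + 1)"
    using ex_power_ivl1[of q k] q \<open>k \<ge> 1\<close> by auto
  define L where "L = a + 1"
  \<comment> \<open>This is n/k rounded up: k(m - 1) < n keeps the degree of F(b) below
    \<open>n\<close>, while n \<le> k m makes \<open>m\<close> large enough for the final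
    estimate.\<close>
  define m where "m = (n - 1) div k + 1"
  have "k * ((n - 1) div k) \<le> n - 1" by (rule times_div_less_eq_dividend)
  then have m1: "k * (m - 1) < n" using assms(5) unfolding m_def add_diff_cancel_right' by linarith
  have "n - 1 < ((n - 1) div k) * k + k"
    using dividend_less_div_times[of k "n - 1"] \<open>k \<ge> 1\<close> by simp
  then have m2: "n \<le> k * m" unfolding m_def by (simp add: algebra_simps)
  have "m \<ge> 1" by (simp add: m_def)

  define P where "P b = (\<Sum>j<m. monom (b j) j)" for b :: "nat \<Rightarrow> 'a"
  define Y where "Y i b = coeff (pcompose F (P b)) i" for i b
  have "degree (P b) \<le> m - 1" for b
    unfolding P_def by (intro degree_sum_le) (auto intro: order.trans[OF degree_monom_le])
  then have "degree (pcompose F (P b)) \<le> k * (m - 1)" for b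
    using assms(2) by (simp add: degree_pcompose)
  then have Y_ge: "Y i b = 0" if "i \<ge> n" for i b
    using that m1 unfolding Y_def by (meson coeff_eq_0 le_less_trans order.strict_trans2)
  have "deg_le m 1 (\<lambda>b. coeff (P b) i)" for i
    by (cases "i < m") (simp_all add: P_def coeff_sum_monom_lessThan deg_le_var[simplified] deg_le_const)
  then have "poly_deg_le m (L * (q - 1)) (\<lambda>b. pcompose F (P b))"
    using a(2) assms(1,2) unfolding L_def
    by (intro poly_deg_le_pcompose[where 'a = 'a, folded assms(1)]) (auto simp: poly_deg_le_def)
  then have deg_Y: "deg_le m (L * (q - 1)) (Y i)" for i
    unfolding Y_def poly_deg_le_def by blast
  obtain c where c:
    "\<And>z. (\<Sum>b\<in>{..<m} \<rightarrow>\<^sub>E UNIV. of_bool (\<forall>i<n. z i = Y i b)) =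
         (\<Sum>e\<in>{..<n} \<rightarrow>\<^sub>E {..<q}. c e * (\<Prod>i<n. z i ^ e i))"
    "\<And>e. c e \<noteq> 0 \<Longrightarrow> m * (q - 1) \<le> L * (q - 1) * (\<Sum>i<n. q - 1 - e i)"
    by (rule count_solutions_polynomial[where n = n, OF deg_Y, folded assms(1)]) (rule that)

  define r where "r = (of_nat (card {x. poly F x = 0}) :: 'a)"
  \<comment> \<open>Comparing the first \<open>n\<close> coefficients suffices, as both sides have
    degree below \<open>n\<close>. Off the diagonal the assumption on \<open>A\<close> leaves no
    solution; on it the solutions correspond to the roots of \<open>F\<close>.\<close>
  have diag: "(\<Sum>b\<in>{..<m} \<rightarrow>\<^sub>E UNIV. of_bool (\<forall>i<n. coeff x i - coeff y i = Y i b)) = (if x = y then r else 0)"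
    if "x \<in> A" "y \<in> A" for x y
  proof -
    have "(\<forall>i<n. coeff x i - coeff y i = Y i b) \<longleftrightarrow> x - y = pcompose F (P b)" for b
    proof -
      have "coeff x i - coeff y i = Y i b" if "i \<ge> n" for i
        using that coeff_polys_below[OF subsetD[OF assms(6)]] \<open>x \<in> A\<close> \<open>y \<in> A\<close> by (simp add: Y_ge)
      then show ?thesis by (auto simp: poly_eq_iff Y_def not_less) (meson not_less)
    qed
    then have "(\<Sum>b\<in>{..<m} \<rightarrow>\<^sub>E UNIV. of_bool (\<forall>i<n. coeff x i - coeff y i = Y i b)) =
        (\<Sum>b\<in>{..<m} \<rightarrow>\<^sub>E UNIV. of_bool (x - y = pcompose F (P b)) :: 'a)" by simp
    also have "\<dots> = of_nat (card {b \<in> {..<m} \<rightarrow>\<^sub>E UNIV. x - y = pcompose F (P b)})"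
      by (simp add: of_bool_def sum.If_cases finite_PiE Int_def)
    also have "\<dots> = (if x = y then r else 0)"
    proof (cases "x = y")
      case True
      then show ?thesis
        using card_pcompose_zeros[OF \<open>F \<noteq> 0\<close> \<open>m \<ge> 1\<close>] by (simp add: r_def P_def eq_commute[of 0])
    next
      case False
      then have "{b \<in> {..<m} \<rightarrow>\<^sub>E UNIV. x - y = pcompose F (P b)} = {}" using no that by blast
      then show ?thesis by (simp only: False card.empty of_nat_0 if_False)
    qed
    finally show ?thesis .
  qed

  \<comment> \<open>After cancelling q - 1, the bound on the exponents reads: total degree at most
    n(q - 1) - m/L. Half of this is n(q - 1)/2 - t.\<close>
  define t where "t = real m / (2 * real L)"
  define S where "S = {u \<in> {..<n} \<rightarrow>\<^sub>E {..<q}. real (\<Sum>i<n. u i) \<le> real n * (real q - 1) / 2 - t}"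
  have "L > 0" by (simp add: L_def)
  have deg: "real (\<Sum>i<n. e i) \<le> 2 * (real n * (real q - 1) / 2 - t)"
    if e: "e \<in> {..<n} \<rightarrow>\<^sub>E {..<q}" "c e \<noteq> 0" for e
  proof -
    have "(q - 1) * m \<le> (q - 1) * (L * (\<Sum>i<n. q - 1 - e i))"
      using c(2)[OF e(2)] by (simp add: mult_ac)
    then have "m \<le> L * (\<Sum>i<n. q - 1 - e i)" using q by simp
    then have "real m \<le> real L * real (\<Sum>i<n. q - 1 - e i)"
      by (metis of_nat_le_iff of_nat_mult)
    moreover have "real (\<Sum>i<n. q - 1 - e i) = (\<Sum>i<n. real q - 1 - real (e i))"
      unfolding of_nat_sum
    proof (rule sum.cong)
      fix i assume "i \<in> {..<n}"
      then have "e i < q" using e by auto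
      then show "real (q - 1 - e i) = real q - 1 - real (e i)" by (simp add: of_nat_diff)
    qed simp
    ultimately have "real m \<le> real L * (real n * (real q - 1) - real (\<Sum>i<n. e i))"
      by (simp add: sum_subtractf)
    then show ?thesis using \<open>L > 0\<close> by (simp add: t_def field_simps)
  qed
  have "r \<noteq> 0"
    unfolding r_def using assms(1,4) by (intro of_nat_coprime_card_neq_0) simp
  then have card_A: "card A \<le> 2 * card S"
    unfolding S_def assms(1)
    by (intro croot_lev_pach[where c = c and d = r and X = coeff] \<open>finite A\<close>
        deg[unfolded assms(1)] c(1)[unfolded assms(1), symmetric, THEN trans] diag)
  have card_S: "real (card S) \<le> real q ^ n * exp (- 2 * t\<^sup>2 / (real n * (real q - 1)\<^sup>2))"
    using card_small_degree_le[OF assms(5) q, of t] by (simp add: S_def t_def)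
  \<comment> \<open>From m \<ge> n/k and L \<le> 1 + log_q k follows 2t \<ge> n / (k (1 + log_q k));
    inserting this lower bound gives exactly the constant \<open>c' k q\<close>.\<close>
  have exponent: "exp (- 2 * t\<^sup>2 / (real n * (real q - 1)\<^sup>2)) \<le> exp (- (c' k q * ln q * n))"
  proof -
    define s where "s = 1 + log q k"
    define w where "w = real q - 1"
    have "w > 0" "real n > 0" "real k > 0" "ln q > 0"
      using q assms(5) \<open>k \<ge> 1\<close> by (auto simp: w_def)
    have "real a \<le> log q k" using a(1) q \<open>k \<ge> 1\<close> by (intro le_log_of_power) (auto simp flip: of_nat_power)
    then have s: "real L \<le> s" "0 < real L" by (auto simp: L_def s_def)
    have "real n / real k \<le> real m"
      using m2 \<open>real k > 0\<close> by (simp add: field_simps flip: of_nat_mult)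
    then have "(real n / real k) / s \<le> real m / real L"
      using s by (intro frac_le) simp_all
    moreover have "real m / real L = 2 * t" by (simp add: t_def)
    ultimately have "(real n / real k) / s \<le> 2 * t" by (rule ord_le_eq_trans)
    then have "((real n / real k) / s)\<^sup>2 \<le> (2 * t)\<^sup>2"
      using s by (intro power_mono) auto
    then have "((real n / real k) / s)\<^sup>2 / (2 * (real n * w\<^sup>2)) \<le> (2 * t)\<^sup>2 / (2 * (real n * w\<^sup>2))"
      by (intro divide_right_mono) auto
    moreover have "((real n / real k) / s)\<^sup>2 / (2 * (real n * w\<^sup>2)) = c' k q * ln q * n"
      using \<open>w > 0\<close> \<open>real n > 0\<close> \<open>real k > 0\<close> \<open>ln q > 0\<close> s
      unfolding c'_def s_def[symmetric] w_def[symmetric]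
      by (simp add: divide_simps power2_eq_square)
    moreover have "(2 * t)\<^sup>2 / (2 * (real n * w\<^sup>2)) = 2 * t\<^sup>2 / (real n * w\<^sup>2)"
      by (simp add: power_mult_distrib)
    ultimately show ?thesis by (simp add: w_def)
  qed
  have "real (card A) \<le> 2 * real (card S)"
    using of_nat_mono[OF card_A, where 'a = real] by simp
  also have "\<dots> \<le> 2 * (real q ^ n * exp (- (c' k q * ln q * n)))"
    by (intro mult_left_mono order.trans[OF card_S] exponent) auto
  also have "real q ^ n = real q powr real n"
    using q by (simp add: powr_realpow)
  also have "real q powr real n * exp (- (c' k q * ln q * n)) = real q powr ((1 - c' k q) * real n)"
  proof -
    have "exp (- (c' k q * ln q * n)) = real q powr (- (c' k q * n))"
      using q by (simp add: powr_def)
    then show ?thesis by (simp add: powr_add[symmetric] left_diff_distrib)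
  qed
  finally show False using assms(7) by simp
qed

end
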